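(* Let $c>0$, and let $\mathcal{F}$ be a class of probability measures on $\mathbb{R}$ that contains all distributions with Lebesgue densities on bounded support. Then any scoring function $S:\mathbb{R}\times\mathbb{R}\to\mathbb{R}$ that is strictly consistent for the functional $m_c$ relative to $\mathcal{F}$ is almost everywhere equal to a scoring function $S'$ which is equivalent to the $c$-zero-one-loss \[ (x,y)\mapsto-\mathbb{1}\{x-c\le y\le x+c\}; \] here almost everywhere equal means that for every $x\in\mathbb{R}$, $S(x,y)=S'(x,y)$ for Lebesgue-almost every $y\in\mathbb{R}$.
   Context: The functional $m_c:\mathcal{F}\to 2^{\mathbb{R}}$ gives the midpoints of the modal intervals $[x-c,x+c]$ of length $2c$: \[ m_c(F)=\arg\max_{x\in\mathbb{R}}\ \mathbb{P}_F(x-c\le Y\le x+c), \] where $Y\sim F$ under $\mathbb{P}_F$. The action domain is $\mathbb{R}$. A measurable function $h:\mathbb{R}\to\mathbb{R}$ is $\mathcal{F}$-integrable if $\mathbb{E}_F h(Y)$ is well-defined and finite for all $F\in\mathcal{F}$. A scoring function is a map $S:\mathbb{R}\times\mathbb{R}\to\mathbb{R}$ such that $S(x,\cdot)$ is $\mathcal{F}$-integrable for all $x\in\mathbb{R}$. It is strictly consistent for a functional $T:\mathcal{F}\to 2^{\mathbb{R}}$ relative to $\mathcal{F}$ if $\mathbb{E}_F S(t,Y)\le\mathbb{E}_F S(x,Y)$ for all $F\in\mathcal{F}$, $t\in T(F)$, $x\in\mathbb{R}$, with equality only if $x\in T(F)$. Scoring functions $S,S'$ are equivalent if $S'(x,y)=\kappa\,S(x,y)+h(y)$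 for all $x,y\in\mathbb{R}$, for some $\kappa>0$ and some $\mathcal{F}$-integrable function $h:\mathbb{R}\to\mathbb{R}$. *)

theory Defs
  imports "HOL-Probability.Probability"
begin

definition F_integrable :: "real measure set \<Rightarrow> (real \<Rightarrow> real) \<Rightarrow> bool" where
  "F_integrable \<F> h \<longleftrightarrow> h \<in> borel_measurable borel \<and> (\<forall>M\<in>\<F>. integrable M h)"

definition scoring_function :: "real measure set \<Rightarrow> (real \<Rightarrow> real \<Rightarrow> real) \<Rightarrow> bool" where
  "scoring_function \<F> S \<longleftrightarrow> (\<forall>x. F_integrable \<F> (S x))"

definition strictly_consistent ::
  "real measure set \<Rightarrow> (real measure \<Rightarrow> real set) \<Rightarrow> (real \<Rightarrow> real \<Rightarrow> real) \<Rightarrow> bool" where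
  "strictly_consistent \<F> T S \<longleftrightarrow>
    (\<forall>M\<in>\<F>. \<forall>t\<in>T M. \<forall>x.
      (\<integral>y. S t y \<partial>M) \<le> (\<integral>y. S x y \<partial>M) \<and>
      ((\<integral>y. S t y \<partial>M) = (\<integral>y. S x y \<partial>M) \<longrightarrow> x \<in> T M))"

text \<open>The relation is symmetric on scoring functions: take \<open>1 / \<kappa>\<close> and \<open>- h / \<kappa>\<close>.\<close>

definition score_equivalent ::
  "real measure set \<Rightarrow> (real \<Rightarrow> real \<Rightarrow> real) \<Rightarrow> (real \<Rightarrow> real \<Rightarrow> real) \<Rightarrow> bool" where
  "score_equivalent \<F> S S' \<longleftrightarrow>
    (\<exists>\<kappa>>0. \<exists>h. F_integrable \<F> h \<and> (\<forall>x y. S' x y = \<kappa> * S x y + h y))"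

text \<open>The set of all maximisers, that is, the midpoints of the modal intervals of length \<open>2 * c\<close>.\<close>

definition modal_midpoints :: "real \<Rightarrow> real measure \<Rightarrow> real set" where
  "modal_midpoints c M = {x. is_arg_max (\<lambda>x. measure M {x - c..x + c}) (\<lambda>_. True) x}"

definition zero_one_loss :: "real \<Rightarrow> real \<Rightarrow> real \<Rightarrow> real" where
  "zero_one_loss c x y = - indicator {x - c..x + c} y"

text \<open>The distributions with a Lebesgue density of bounded support. The closure in the definition
  of support is omitted, as it does not affect boundedness.\<close>

definition bounded_support_density_distributions :: "real measure set" where
  "bounded_support_density_distributions =
    {density lborel (\<lambda>y. ennreal (f y)) | f :: real \<Rightarrow> real.
      f \<in> borel_measurable borel \<and> (\<forall>y. 0 \<le> f y) \<and> bounded {y. f y \<noteq> 0} \<and>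
      (\<integral>\<^sup>+ y. ennreal (f y) \<partial>lborel) = 1}"

end

theory Submission
  imports Defs
begin

text \<open>A density that has both \<open>x\<close> and \<open>z\<close> among its modal midpoints integrates \<open>S x - S z\<close> to zero.
  If \<open>x\<close> and \<open>z\<close> are more than \<open>4 * c\<close> apart, no interval of length \<open>2 * c\<close> meets both modal
  intervals, so every density that lives on the two intervals and gives them equal mass is of this
  kind. This forces \<open>S x - S z\<close> to be almost everywhere a constant \<open>- k\<close> on the first interval and
  \<open>k\<close> on the second. A density that is \<open>1\<close> on both intervals may be anything between \<open>0\<close> and \<open>1\<close>
  elsewhere, so the difference vanishes there. Additivity along three distant
  points shows that \<open>k\<close> does not depend on the pair, and two arbitrary points are compared through a
  third one far away from both.\<close>

text \<open>\<open>f\<close> is integrable only on bounded sets, so uniqueness of integrable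
  densities is applied to its truncations to \<open>{- real n..real n}\<close>. Countably many null
  sets are discarded, and every point lies in some truncation interval.\<close>

lemma AE_zero_if_bounded_set_integrals_zero:
  fixes f :: "real \<Rightarrow> real"
  assumes int: "\<And>A. A \<in> sets borel \<Longrightarrow> bounded A \<Longrightarrow> set_integrable lborel A f"
    and zero: "\<And>A. A \<in> sets borel \<Longrightarrow> bounded A \<Longrightarrow> (LINT y:A|lborel. f y) = 0"
  shows "AE y in lborel. f y = 0"
proof -
  have "AE y in lborel. indicator {- real n..real n} y * f y = 0" for n
  proof (rule density_unique_real)
    show "integrable lborel (\<lambda>y. indicator {- real n..real n} y * f y)"
      using int[of "{- real n..real n}"] by (simp add: set_integrable_def)
    show "integrable lborel (\<lambda>y. 0 :: real)" by simp
    fix A :: "real set" assume "A \<in> sets lborel"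
    then have "(LINT y:A \<inter> {- real n..real n}|lborel. f y) = 0"
      by (intro zero) (auto intro: bounded_subset[OF bounded_closed_interval])
    then show "(LINT y:A|lborel. indicator {- real n..real n} y * f y) = (LINT y:A|lborel. 0)"
      by (simp add: set_lebesgue_integral_def indicator_inter_arith mult.assoc)
  qed
  then have "AE y in lborel. \<forall>n. indicator {- real n..real n} y * f y = 0"
    unfolding AE_all_countable by blast
  then show ?thesis
  proof eventually_elim
    case (elim y)
    obtain n where "\<bar>y\<bar> \<le> real n" using real_arch_simple by blast
    then show ?case using elim[rule_format, of n] by (auto split: split_indicator_asm)
  qed
qed

section \<open>Expected scores under unnormalised densities\<close>

locale modal_score =
  fixes c :: real and \<F> :: "real measure set" and S :: "real \<Rightarrow> real \<Rightarrow> real"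
  assumes c_pos: "c > 0"
    and densities: "bounded_support_density_distributions \<subseteq> \<F>"
    and scoring: "scoring_function \<F> S"
    and consistent: "strictly_consistent \<F> (modal_midpoints c) S"
begin

abbreviation window :: "real \<Rightarrow> real set" where
  "window x \<equiv> {x - c..x + c}"

text \<open>This is the condition of being a modal midpoint, phrased for an unnormalised density so
  that later constructions need no division by the total mass.\<close>

definition dominates :: "(real \<Rightarrow> real) \<Rightarrow> real \<Rightarrow> bool" where
  "dominates f x \<longleftrightarrow> (\<forall>t. (LINT y:window t|lborel. f y) \<le> (LINT y:window x|lborel. f y))"

lemma S_measurable [measurable]: "S x \<in> borel_measurable borel"
  using scoring by (auto simp: scoring_function_def F_integrable_def)

context
  fixes f :: "real \<Rightarrow> real"
  assumes meas [measurable]: "f \<in> borel_measurable borel" and nonneg: "\<And>y. 0 \<le> f y"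
    and bdd: "bounded {y. f y \<noteq> 0}" and int: "integrable lborel f"
begin

lemma normalised_density_in_class:
  assumes "(LINT y|lborel. f y) = m" "m > 0"
  shows "density lborel (\<lambda>y. ennreal (f y / m)) \<in> \<F>"
proof -
  have "(\<integral>\<^sup>+ y. ennreal (f y / m) \<partial>lborel) = ennreal (LINT y|lborel. f y / m)"
    using nonneg int assms by (intro nn_integral_eq_integral) auto
  also have "\<dots> = 1" using assms by simp
  finally have "density lborel (\<lambda>y. ennreal (f y / m)) \<in> bounded_support_density_distributions"
    unfolding bounded_support_density_distributions_def using nonneg assms bdd
    by (intro CollectI exI[of _ "\<lambda>y. f y / m"]) auto
  then show ?thesis using densities by blast
qed

lemma integral_normalised_density:
  assumes "m > 0" and [measurable]: "h \<in> borel_measurable borel"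
  shows "(LINT y|density lborel (\<lambda>y. ennreal (f y / m)). h y) = (LINT y|lborel. f y * h y) / m"
  using assms nonneg by (subst integral_real_density) auto

lemma modal_midpoints_normalised_density:
  assumes "(LINT y|lborel. f y) = m" "m > 0"
  shows "x \<in> modal_midpoints c (density lborel (\<lambda>y. ennreal (f y / m))) \<longleftrightarrow> dominates f x"
proof -
  let ?M = "density lborel (\<lambda>y. ennreal (f y / m))"
  have "measure ?M (window t) = (LINT y:window t|lborel. f y) / m" for t
  proof -
    have "measure ?M (window t) = (LINT y|?M. indicator (window t) y)" by simp
    also have "\<dots> = (LINT y:window t|lborel. f y) / m"
      using assms by (subst integral_normalised_density) (auto simp: set_lebesgue_integral_def mult.commute)
    finally show ?thesis .
  qed
  then show ?thesis using \<open>m > 0\<close>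
    by (auto simp: modal_midpoints_def is_arg_max_def dominates_def not_less divide_le_cancel)
qed

text \<open>A positive multiple of \<open>f\<close> is the density of a member of
  \<open>\<F>\<close>, and scores are integrable against every member.\<close>

lemma integrable_mult_score:
  assumes "(LINT y|lborel. f y) > 0"
  shows "integrable lborel (\<lambda>y. f y * S x y)"
proof -
  define m where "m = (LINT y|lborel. f y)"
  have "integrable (density lborel (\<lambda>y. ennreal (f y / m))) (S x)"
    using normalised_density_in_class[of m] assms scoring
    by (auto simp: m_def scoring_function_def F_integrable_def)
  then have "integrable lborel (\<lambda>y. f y / m * S x y)"
    using assms nonneg by (subst (asm) integrable_real_density) (auto simp: m_def)
  from integrable_mult_right[OF this, of m] show ?thesis using assms by (simp add: m_def)
qed

lemma score_strict:
  assumes "dominates f x" "\<not> dominates f z" "(LINT y|lborel. f y) > 0"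
  shows "(LINT y|lborel. f y * S x y) < (LINT y|lborel. f y * S z y)"
proof -
  define m where "m = (LINT y|lborel. f y)"
  note m = m_def[symmetric] assms(3)[folded m_def]
  have "(LINT y|density lborel (\<lambda>y. ennreal (f y / m)). S x y)
      < (LINT y|density lborel (\<lambda>y. ennreal (f y / m)). S z y)"
    using consistent normalised_density_in_class[OF m] modal_midpoints_normalised_density[OF m] assms
    unfolding strictly_consistent_def by (meson order_less_le)
  then show ?thesis
    using m by (simp add: integral_normalised_density divide_less_cancel)
qed

text \<open>Both points are modal midpoints, so each minimises the expected score and antisymmetry
  applies.\<close>

lemma score_eq:
  assumes "dominates f x" "dominates f z"
  shows "(LINT y|lborel. f y * S x y) = (LINT y|lborel. f y * S z y)"
\<comment> \<open>A function of total mass zero cannot be normalised. The case does occur, since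
  \<open>gap_inside_window\<close> also covers null sets \<open>A\<close>.\<close>
proof (cases "(LINT y|lborel. f y) = 0")
  case True
  then have "AE y in lborel. f y = 0"
    using integral_nonneg_eq_0_iff_AE[OF int] nonneg by simp
  then show ?thesis by (intro integral_cong_AE) auto
next
  case False
  define m where "m = (LINT y|lborel. f y)"
  have "m > 0" using False nonneg by (simp add: m_def order_less_le)
  note m = m_def[symmetric] this
  have "(LINT y|density lborel (\<lambda>y. ennreal (f y / m)). S x y)
      = (LINT y|density lborel (\<lambda>y. ennreal (f y / m)). S z y)"
    using consistent normalised_density_in_class[OF m] modal_midpoints_normalised_density[OF m] assms
    unfolding strictly_consistent_def by (meson order_antisym)
  then show ?thesis
    using m by (simp add: integral_normalised_density)
qed

end

text \<open>The uniform density on a symmetric interval containing \<open>A\<close> gives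
  integrability on that interval.\<close>

lemma set_integrable_score:
  assumes "A \<in> sets borel" "bounded A"
  shows "set_integrable lborel A (S x)"
proof -
  obtain r where r: "r > 0" "A \<subseteq> {-r..r}"
  proof -
    from \<open>bounded A\<close> obtain r where "r > 0" "\<forall>y\<in>A. norm y \<le> r" unfolding bounded_pos by blast
    then show ?thesis by (intro that[of r]) (auto simp: abs_le_iff)
  qed
  have "set_integrable lborel {-r..r} (S x)"
    unfolding set_integrable_def real_scaleR_def using r(1)
    by (intro integrable_mult_score)
       (auto intro!: bounded_subset[OF bounded_closed_interval[of "-r" r]] split: split_indicator_asm)
  then show ?thesis by (rule set_integrable_subset) (use assms r in auto)
qed


section \<open>Functions with prescribed modal midpoints\<close>

lemma integrable_indicator_bounded:
  fixes A :: "real set"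
  assumes "A \<in> sets borel" "bounded A"
  shows "integrable lborel (indicator A :: real \<Rightarrow> real)"
  using assms emeasure_bounded_finite[of A] by (intro integrable_real_indicator) auto

lemma integrable_window [simp]: "integrable lborel (indicator (window x) :: real \<Rightarrow> real)"
  by (intro integrable_indicator_bounded) auto

text \<open>The length \<open>2 * c\<close> bounds the integral of \<open>f\<close> over every
  window, and \<open>window x\<close> attains this bound.\<close>

lemma dominates_if_le_one:
  assumes "f \<in> borel_measurable borel" "integrable lborel f"
    and "\<And>y. f y \<le> 1" "\<And>y. y \<in> window x \<Longrightarrow> f y = 1"
  shows "dominates f x"
  unfolding dominates_def
proof
  fix t
  have one: "set_integrable lborel (window s) (\<lambda>y. 1 :: real)" for s
    using integrable_window[of s] by (simp add: set_integrable_def)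
  have "set_integrable lborel (window t) f"
    unfolding set_integrable_def using assms by (intro integrable_mult_indicator) auto
  then have "(LINT y:window t|lborel. f y) \<le> (LINT y:window t|lborel. 1)"
    using assms one by (intro set_integral_mono) auto
  also have "\<dots> = 2 * c" using c_pos by (simp add: set_lebesgue_integral_def)
  also have "2 * c = (LINT y:window x|lborel. 1)" using c_pos by (simp add: set_lebesgue_integral_def)
  also have "\<dots> = (LINT y:window x|lborel. f y)"
    using assms by (intro set_lebesgue_integral_cong) auto
  finally show "(LINT y:window t|lborel. f y) \<le> (LINT y:window x|lborel. f y)" .
qed

text \<open>A window that misses \<open>window z\<close> collects mass only from
  \<open>window x\<close>, and conversely. Every window misses at least one of the two.\<close>

lemma dominates_if_two_windows:
  assumes far: "4 * c < \<bar>x - z\<bar>" and int: "integrable lborel f" and nonneg: "\<And>y. 0 \<le> f y"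
    and supp: "\<And>y. y \<notin> window x \<union> window z \<Longrightarrow> f y = 0"
    and eq: "(LINT y:window x|lborel. f y) = (LINT y:window z|lborel. f y)"
  shows "dominates f x"
  unfolding dominates_def
proof
  fix t
  have mono: "(LINT y:window t|lborel. f y) \<le> (LINT y:window s|lborel. f y)"
    if "\<And>y. y \<in> window t \<Longrightarrow> y \<notin> window s \<Longrightarrow> f y = 0" for s
    unfolding set_lebesgue_integral_def using int nonneg that
    by (intro integral_mono integrable_mult_indicator) (auto split: split_indicator)
  \<comment> \<open>Points of the two windows are more than \<open>2 * c\<close> apart, which is the
    length of \<open>window t\<close>.\<close>
  have "(\<forall>y. y \<in> window t \<longrightarrow> y \<notin> window z) \<or> (\<forall>y. y \<in> window t \<longrightarrow> y \<notin> window x)"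
    using far by (auto simp: abs_if split: if_splits)
  then show "(LINT y:window t|lborel. f y) \<le> (LINT y:window x|lborel. f y)"
    using mono[of x] mono[of z] supp eq by auto
qed

section \<open>Integrals of score differences over bounded sets\<close>

definition gap :: "real \<Rightarrow> real \<Rightarrow> real set \<Rightarrow> real" where
  "gap x z A = (LINT y:A|lborel. S x y - S z y)"

lemma gap_Un:
  assumes "A \<in> sets borel" "bounded A" "B \<in> sets borel" "bounded B" "A \<inter> B = {}"
  shows "gap x z (A \<union> B) = gap x z A + gap x z B"
  unfolding gap_def using assms
  by (intro set_integral_Un set_integral_diff set_integrable_score) auto

lemma gap_eq:
  assumes "A \<in> sets borel" "bounded A"
  shows "gap x z A = (LINT y:A|lborel. S x y) - (LINT y:A|lborel. S z y)"
  unfolding gap_def using assms by (intro set_integral_diff set_integrable_score) auto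

lemma gap_commute:
  assumes "A \<in> sets borel" "bounded A"
  shows "gap z x A = - gap x z A"
  using assms by (simp add: gap_eq)

text \<open>The indicator of \<open>A\<close> is at most one and equals one on both windows, so
  \<open>x\<close> and \<open>z\<close> are both modal and their expected scores agree.\<close>

lemma gap_superset_windows:
  assumes A: "A \<in> sets borel" "bounded A" "window x \<union> window z \<subseteq> A"
  shows "gap x z A = 0"
proof -
  have "dominates (indicator A) x" "dominates (indicator A) z"
    using A by (auto intro!: dominates_if_le_one integrable_indicator_bounded split: split_indicator)
  then have "(LINT y|lborel. indicator A y * S x y) = (LINT y|lborel. indicator A y * S z y)"
    using A by (intro score_eq integrable_indicator_bounded) (auto elim: bounded_subset split: split_indicator_asm)
  then show ?thesis using A by (simp add: gap_eq set_lebesgue_integral_def)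
qed

text \<open>The union of the windows has gap zero with or without \<open>A\<close>; additivity
  isolates the contribution of \<open>A\<close>.\<close>

lemma gap_outside_windows:
  assumes "A \<in> sets borel" "bounded A" "A \<inter> (window x \<union> window z) = {}"
  shows "gap x z A = 0"
  using gap_Un[of A "window x \<union> window z" x z] assms
    gap_superset_windows[of "window x \<union> window z" x z]
    gap_superset_windows[of "A \<union> (window x \<union> window z)" x z]
  by auto

lemma gap_windows:
  assumes "4 * c < \<bar>x - z\<bar>"
  shows "gap x z (window x) = - gap x z (window z)"
  using gap_Un[of "window x" "window z" x z] gap_superset_windows[of "window x \<union> window z" x z] assms
  by (auto simp: disjoint_iff)

text \<open>Inside \<open>window x\<close> the gap is proportional to Lebesgue measure, which later
  makes the score difference constant there. The proof balances \<open>A\<close> against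
  \<open>window z\<close>.\<close>

lemma gap_inside_window:
  assumes A: "A \<in> sets borel" "A \<subseteq> window x" and far: "4 * c < \<bar>x - z\<bar>"
  shows "2 * c * gap x z A = - measure lborel A * gap x z (window z)"
proof -
  \<comment> \<open>The weights are crosswise: \<open>A\<close> is weighted by the length of
    \<open>window z\<close>, and \<open>window z\<close> by the measure of \<open>A\<close>. Hence
    both windows carry mass \<open>2 * c * measure lborel A\<close>.\<close>
  define f where "f y = 2 * c * indicator A y + measure lborel A * indicator (window z) y" for y
  have bA: "bounded A" using A bounded_subset bounded_closed_interval by blast
  have int: "integrable lborel f" unfolding f_def using A bA integrable_window
    by (intro Bochner_Integration.integrable_add integrable_mult_right integrable_indicator_bounded) auto
  have disj: "window x \<inter> window z = {}" using far by auto
  have [measurable]: "A \<in> sets borel" by fact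
  have fA: "(LINT y:window x|lborel. f y) = 2 * c * measure lborel A"
  proof -
    have "(LINT y:window x|lborel. f y) = (LINT y|lborel. 2 * c * indicator A y)"
      unfolding set_lebesgue_integral_def f_def using A disj
      by (intro Bochner_Integration.integral_cong) (auto split: split_indicator)
    then show ?thesis by simp
  qed
  have fz: "(LINT y:window z|lborel. f y) = 2 * c * measure lborel A"
  proof -
    have "(LINT y:window z|lborel. f y) = (LINT y|lborel. measure lborel A * indicator (window z) y)"
      unfolding set_lebesgue_integral_def f_def using A disj
      by (intro Bochner_Integration.integral_cong) (auto split: split_indicator)
    then show ?thesis using c_pos by simp
  qed
  have nonneg: "0 \<le> f y" for y using c_pos by (simp add: f_def)
  have supp: "f y = 0" if "y \<notin> window x \<union> window z" for y
    using that A by (auto simp: f_def split: split_indicator)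
  have "dominates f x"
    by (rule dominates_if_two_windows[OF far int nonneg]) (erule supp, simp only: fA fz)
  moreover have "dominates f z"
  proof (rule dominates_if_two_windows[OF _ int nonneg])
    show "4 * c < \<bar>z - x\<bar>" using far by linarith
    show "f y = 0" if "y \<notin> window z \<union> window x" for y using that supp by blast
  qed (simp only: fA fz)
  moreover have "bounded {y. f y \<noteq> 0}"
  proof (rule bounded_subset)
    show "bounded (window x \<union> window z)" by simp
    show "{y. f y \<noteq> 0} \<subseteq> window x \<union> window z" using supp by blast
  qed
  moreover have "f \<in> borel_measurable borel" unfolding f_def by measurable
  ultimately have "(LINT y|lborel. f y * S x y) = (LINT y|lborel. f y * S z y)"
    using int nonneg by (intro score_eq)
  moreover have "(LINT y|lborel. f y * S w y)
      = 2 * c * (LINT y:A|lborel. S w y) + measure lborel A * (LINT y:window z|lborel. S w y)" for w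
  proof -
    have "set_integrable lborel A (S w)" "set_integrable lborel (window z) (S w)"
      using A bA by (auto intro: set_integrable_score)
    then show ?thesis
      by (simp add: f_def set_integrable_def set_lebesgue_integral_def distrib_right mult.assoc)
  qed
  ultimately show ?thesis using A bA by (simp add: gap_eq algebra_simps)
qed

section \<open>Score differences as multiples of zero-one loss differences\<close>

definition zero_one_gap :: "real \<Rightarrow> real \<Rightarrow> real \<Rightarrow> bool" where
  "zero_one_gap k x z \<longleftrightarrow>
    (AE y in lborel. S x y - S z y = k * (indicator (window z) y - indicator (window x) y))"

text \<open>The constant is the mean of \<open>S x - S z\<close> over \<open>window z\<close>. The
  identity is tested by integration over all bounded Borel sets.\<close>

lemma zero_one_gap_far:
  assumes far: "4 * c < \<bar>x - z\<bar>"
  shows "zero_one_gap (gap x z (window z) / (2 * c)) x z"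
proof -
  define k where "k = gap x z (window z) / (2 * c)"
  let ?e = "\<lambda>y. (S x y - S z y) - k * (indicator (window z) y - indicator (window x) y)"
  have disj: "window x \<inter> window z = {}" using far by auto
  have int_ind: "set_integrable lborel A (\<lambda>y. k * (indicator (window z) y - indicator (window x) y))"
    if "A \<in> sets borel" for A
    unfolding set_integrable_def using that
    by (intro integrable_mult_indicator integrable_mult_right Bochner_Integration.integrable_diff integrable_window) auto
  have int_S: "set_integrable lborel A (\<lambda>y. S x y - S z y)" if "A \<in> sets borel" "bounded A" for A
    using that by (intro set_integral_diff set_integrable_score)
  have "AE y in lborel. ?e y = 0"
  proof (rule AE_zero_if_bounded_set_integrals_zero)
    fix A :: "real set" assume A: "A \<in> sets borel" "bounded A"
    then show "set_integrable lborel A ?e"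
      by (intro set_integral_diff int_ind int_S)
    let ?A = "\<lambda>B. A \<inter> B"
    \<comment> \<open>Additivity reduces the test to two pieces inside a window, where the gap is
      proportional to measure, and one outside both, where it vanishes.\<close>
    have split: "A = (?A (window x) \<union> ?A (window z)) \<union> (A - (window x \<union> window z))" by auto
    have bdd: "bounded B" if "B \<subseteq> A" for B using A that bounded_subset by blast
    have "gap x z A = gap x z (?A (window x)) + gap x z (?A (window z)) + gap x z (A - (window x \<union> window z))"
      using A disj by (subst split, subst gap_Un, simp_all add: bdd, blast, subst gap_Un) (auto intro: bdd)
    also have "gap x z (A - (window x \<union> window z)) = 0"
      using A by (intro gap_outside_windows) (auto intro: bdd)
    also have "gap x z (?A (window x)) = - k * measure lborel (?A (window x))"
      using gap_inside_window[of "?A (window x)" x z] A far c_pos by (simp add: k_def field_simps)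
    also have "gap x z (?A (window z)) = k * measure lborel (?A (window z))"
    proof -
      \<comment> \<open>Interchanging \<open>x\<close> and \<open>z\<close> flips the sign of the
        gap, and \<open>gap_windows\<close> turns its value on \<open>window x\<close> into that on
        \<open>window z\<close>.\<close>
      have "2 * c * gap x z (?A (window z)) = measure lborel (?A (window z)) * gap x z (window z)"
        using gap_inside_window[of "?A (window z)" z x] A far gap_windows[OF far]
          gap_commute[of "?A (window z)" z x] gap_commute[of "window x" z x]
        by (simp add: abs_minus_commute bdd)
      then show ?thesis using c_pos by (simp add: k_def field_simps)
    qed
    finally have "gap x z A = k * (measure lborel (?A (window z)) - measure lborel (?A (window x)))"
      by (simp add: algebra_simps)
    also have "\<dots> = (LINT y:A|lborel. k * (indicator (window z) y - indicator (window x) y))"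
    proof -
      have "integrable lborel (indicator (?A (window w)) :: real \<Rightarrow> real)" for w
        using A by (intro integrable_indicator_bounded) (auto intro: bdd)
      then have "(LINT y|lborel. k * (indicator (?A (window z)) y - indicator (?A (window x)) y))
          = k * (measure lborel (?A (window z)) - measure lborel (?A (window x)))"
        by simp
      moreover have "(LINT y:A|lborel. k * (indicator (window z) y - indicator (window x) y))
          = (LINT y|lborel. k * (indicator (?A (window z)) y - indicator (?A (window x)) y))"
        unfolding set_lebesgue_integral_def
        by (intro Bochner_Integration.integral_cong) (auto split: split_indicator)
      ultimately show ?thesis by (simp only:)
    qed
    finally show "(LINT y:A|lborel. ?e y) = 0"
      using A by (simp add: gap_def set_integral_diff(2)[OF int_S int_ind])
  qed
  then show ?thesis by (simp add: zero_one_gap_def k_def)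
qed

text \<open>The uniform distribution on \<open>window x\<close> has \<open>x\<close> but not
  \<open>z\<close> as a modal midpoint. Strict consistency makes the gap negative on
  \<open>window x\<close>, and the two windows carry opposite gaps.\<close>

lemma gap_window_pos:
  assumes far: "4 * c < \<bar>x - z\<bar>"
  shows "gap x z (window z) > 0"
proof -
  let ?f = "indicator (window x) :: real \<Rightarrow> real"
  have "dominates ?f x" by (intro dominates_if_le_one integrable_window) (auto split: split_indicator)
  moreover have "\<not> dominates ?f z"
  proof
    have disj: "window x \<inter> window z = {}" using far by auto
    have "(LINT y:window z|lborel. ?f y) = (LINT y:window z|lborel. 0)"
      using disj by (intro set_lebesgue_integral_cong) auto
    then have "(LINT y:window z|lborel. ?f y) = 0" by simp
    moreover have "(LINT y:window x|lborel. ?f y) = 2 * c"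
      using c_pos by (simp add: set_lebesgue_integral_def flip: indicator_inter_arith)
    moreover assume "dominates ?f z"
    ultimately show False using c_pos unfolding dominates_def by (metis not_less mult_pos_pos zero_less_numeral)
  qed
  ultimately have "(LINT y|lborel. ?f y * S x y) < (LINT y|lborel. ?f y * S z y)"
    using c_pos by (intro score_strict integrable_window) (auto intro: bounded_subset[OF bounded_closed_interval] split: split_indicator_asm)
  then have "gap x z (window x) < 0" by (simp add: gap_eq set_lebesgue_integral_def)
  then show ?thesis using gap_windows[OF far] by simp
qed

section \<open>Independence of the constant from the pair of points\<close>

lemma zero_one_gap_commute: "zero_one_gap k x z \<Longrightarrow> zero_one_gap k z x"
  unfolding zero_one_gap_def by (elim AE_mp) (auto simp: algebra_simps)

text \<open>The terms with \<open>w\<close> telescope. This reaches pairs that are close together by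
  way of a distant \<open>w\<close>.\<close>

lemma zero_one_gap_trans:
  assumes "zero_one_gap k x w" "zero_one_gap k w z"
  shows "zero_one_gap k x z"
  using assms unfolding zero_one_gap_def
proof eventually_elim
  case (elim y)
  then show ?case by (simp add: right_diff_distrib)
qed

text \<open>On \<open>window z\<close>, which avoids the other two windows, \<open>S x - S z\<close>
  is \<open>k\<close>, \<open>S z - S w\<close> is minus its own constant, and
  \<open>S x - S w\<close> vanishes. So the two constants agree.\<close>

lemma zero_one_gap_extend:
  assumes xz: "zero_one_gap k x z"
    and far: "4 * c < \<bar>x - z\<bar>" "4 * c < \<bar>z - w\<bar>" "4 * c < \<bar>x - w\<bar>"
  shows "zero_one_gap k z w"
proof -
  obtain l j where l: "zero_one_gap l z w" and j: "zero_one_gap j x w"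
    using zero_one_gap_far far by blast
  have "AE y in lborel. y \<in> window z \<longrightarrow> k = l"
    using xz l j unfolding zero_one_gap_def
  proof eventually_elim
    case (elim y)
    show ?case
    proof
      assume "y \<in> window z"
      moreover from this have "y \<notin> window x" "y \<notin> window w" using far by auto
      ultimately show "k = l" using elim by simp
    qed
  qed
  \<comment> \<open>The equation does not involve \<open>y\<close> and \<open>window z\<close> has
    positive measure, so it holds outright.\<close>
  then have "k = l"
  proof (rule contrapos_pp)
    assume "k \<noteq> l"
    moreover have "\<not> (AE y in lborel. y \<notin> window z)"
      using c_pos by (subst AE_iff_measurable[of "window z"]) auto
    ultimately show "\<not> (AE y in lborel. y \<in> window z \<longrightarrow> k = l)" by simp
  qed
  then show ?thesis using l by simp
qed

lemma uniform_zero_one_gap: "\<exists>k>0. \<forall>x z. zero_one_gap k x z"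
proof -
  define a where "a = 5 * c"
  have a: "4 * c < \<bar>0 - a\<bar>" using c_pos by (simp add: a_def)
  define k where "k = gap 0 a (window a) / (2 * c)"
  have "k > 0" using gap_window_pos[OF a] c_pos by (simp add: k_def)
  moreover have 0: "zero_one_gap k 0 a" using zero_one_gap_far[OF a] by (simp add: k_def)
  have far: "zero_one_gap k w x" if w: "\<bar>x\<bar> + 10 * c \<le> w" for x w
  proof -
    \<comment> \<open>The constant travels along the pairs \<open>0, a\<close>, then
      \<open>a, ?v\<close>, then \<open>?v, w\<close>, then \<open>w, x\<close>. As \<open>w\<close>
      is at least \<open>10 * c\<close>, both \<open>w\<close> and \<open>?v\<close> are more than
      \<open>4 * c\<close> away from \<open>0\<close> and \<open>a\<close>.\<close>
    let ?v = "w + 5 * c"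
    have "zero_one_gap k a ?v"
      by (rule zero_one_gap_extend[OF 0 a]) (use c_pos w in \<open>auto simp: a_def\<close>)
    then have "zero_one_gap k ?v w"
      by (rule zero_one_gap_extend) (use c_pos w in \<open>auto simp: a_def\<close>)
    then show ?thesis
      by (rule zero_one_gap_extend) (use c_pos w in auto)
  qed
  \<comment> \<open>A single point far to the right of both \<open>x\<close> and \<open>z\<close>
    serves as the intermediary.\<close>
  have "zero_one_gap k x z" for x z
    using far[of x "max \<bar>x\<bar> \<bar>z\<bar> + 10 * c"] far[of z "max \<bar>x\<bar> \<bar>z\<bar> + 10 * c"]
    by (auto intro: zero_one_gap_trans zero_one_gap_commute)
  ultimately show ?thesis by blast
qed

end

theorem theorem3p10:
  fixes c :: real and \<F> :: "real measure set" and S :: "real \<Rightarrow> real \<Rightarrow> real"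
  assumes "c > 0"
    and "\<And>M. M \<in> \<F> \<Longrightarrow> real_distribution M"
    and "bounded_support_density_distributions \<subseteq> \<F>"
    and "scoring_function \<F> S"
    and "strictly_consistent \<F> (modal_midpoints c) S"
  shows "\<exists>S'. scoring_function \<F> S' \<and> score_equivalent \<F> (zero_one_loss c) S' \<and>
           (\<forall>x. AE y in lborel. S x y = S' x y)"
proof -
  interpret modal_score c \<F> S
    using assms by unfold_locales
  obtain k where k: "k > 0" "\<And>x z. zero_one_gap k x z"
    using uniform_zero_one_gap by blast
  \<comment> \<open>The added indicator makes \<open>S' 0\<close> equal to \<open>S 0\<close>
    exactly; comparing any \<open>x\<close> with the base point \<open>0\<close> then gives the
    almost everywhere equality.\<close>
  define h where "h y = S 0 y + k * indicator (window 0) y" for y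
  have ind: "F_integrable \<F> (\<lambda>y. a * indicator (window x) y)" for a x :: real
    unfolding F_integrable_def
  proof (intro conjI ballI)
    fix M assume "M \<in> \<F>"
    then interpret real_distribution M by (rule assms)
    show "integrable M (\<lambda>y. a * indicator (window x) y)"
      by (intro integrable_mult_right integrable_real_indicator) (auto simp: emeasure_eq_measure)
  qed simp
  have add: "F_integrable \<F> (\<lambda>y. f y + g y)" if "F_integrable \<F> f" "F_integrable \<F> g" for f g
    using that by (auto simp: F_integrable_def)
  have h: "F_integrable \<F> h"
    unfolding h_def using scoring by (intro add ind) (simp add: scoring_function_def)
  define S' where "S' x y = k * zero_one_loss c x y + h y" for x y
  have "F_integrable \<F> (S' x)" for x
  proof -
    have "S' x = (\<lambda>y. - k * indicator (window x) y + h y)"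
      by (simp add: S'_def zero_one_loss_def fun_eq_iff)
    then show ?thesis using add[OF ind h] by (simp only:)
  qed
  moreover have "score_equivalent \<F> (zero_one_loss c) S'"
    unfolding score_equivalent_def S'_def using k(1) h by blast
  moreover have "AE y in lborel. S x y = S' x y" for x
    using k(2)[of x 0] unfolding zero_one_gap_def
    by eventually_elim (simp add: S'_def h_def zero_one_loss_def algebra_simps)
  ultimately show ?thesis unfolding scoring_function_def by blast
qed

end
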